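(* Let $\Pi=\{\pi_1,\ldots,\pi_\ell\}$ be a partition of $[n]=\{1,\ldots,n\}$ and let $C'=(c'_{ij})$ be an $n\times n$ matrix satisfying $c'_{ij}=c'_{kj}$ for all $i,k$ in the same part $\pi_a$ of $\Pi$ and all $j\in[n]$. Then $C'$ and its quotient matrix $\Pi(C')$ with respect to $\Pi$ have the same set of nonzero eigenvalues. In particular, $\rho(C')=\rho(\Pi(C'))$.
   Context: All matrices are real; eigenvalues are complex eigenvalues and $\rho$ denotes the spectral radius (maximum modulus of eigenvalues). The quotient matrix of $C'$ with respect to $\Pi$ is the $\ell\times\ell$ matrix $\Pi(C')=(\pi'_{ab})$ with $\pi'_{ab}=\frac{1}{|\pi_a|}\sum_{i\in\pi_a,\,j\in\pi_b}c'_{ij}$. *)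

theory Defs
  imports "Jordan_Normal_Form.Spectral_Radius" "HOL-Library.Disjoint_Sets"
begin

text \<open>
  Matrices use 0-based indices, so \<open>[n]\<close> is rendered as \<open>{..<n}\<close>.  An indexed partition
  \<open>\<pi>\<^sub>1, \<dots>, \<pi>\<^sub>l\<close> of it is a list of pairwise distinct parts whose set of entries is a
  partition; as for every partition, the parts are non-empty.
\<close>

definition indexed_partition :: "nat \<Rightarrow> nat set list \<Rightarrow> bool" where
  "indexed_partition n P \<longleftrightarrow> distinct P \<and> partition_on {..<n} (set P)"

definition quotient_mat :: "nat set list \<Rightarrow> real mat \<Rightarrow> real mat" where
  "quotient_mat P C = mat (length P) (length P)
     (\<lambda>(a, b). (1 / real (card (P ! a))) * (\<Sum>i\<in>P ! a. \<Sum>j\<in>P ! b. C $$ (i, j)))"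

text \<open>
  Eigenvalues of a real matrix are its complex eigenvalues: the library notions
  \<^const>\<open>spectrum\<close> and \<^const>\<open>spectral_radius\<close> are applied to the complexified matrix.
\<close>

abbreviation complexify :: "real mat \<Rightarrow> complex mat" where
  "complexify \<equiv> map_mat complex_of_real"

end

theory Submission
  imports Defs
begin

text \<open>
  Let \<open>S\<close> be the \<open>n \<times> l\<close> incidence matrix of points and parts, and let \<open>D\<close> be the \<open>l \<times> n\<close> matrix
  whose \<open>a\<close>-th row is the average of the rows of \<open>C\<close> indexed by \<open>\<pi>\<^sub>a\<close>.  The quotient matrix is always
  \<open>D * S\<close>, and since the rows of \<open>C\<close> agree within a part, \<open>C = S * D\<close>.  The products \<open>S * D\<close>
  and \<open>D * S\<close> have the same nonzero eigenvalues.
\<close>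

text \<open>If \<open>v\<close> is an eigenvector of \<open>A * B\<close> for \<open>k\<close>, then
  \<open>w = B *\<^sub>v v\<close> is one of \<open>B * A\<close>. It cannot vanish, because
  \<open>A\<close> maps it to \<open>k\<close> times \<open>v\<close>, which is nonzero as
  \<open>k\<close> is.\<close>

lemma eigenvalue_mult_swap:
  fixes A B :: "'a :: field mat"
  assumes A: "A \<in> carrier_mat m n" and B: "B \<in> carrier_mat n m"
    and "eigenvalue (A * B) k" and k: "k \<noteq> 0"
  shows "eigenvalue (B * A) k"
proof -
  obtain v where v: "v \<in> carrier_vec m" "v \<noteq> 0\<^sub>v m" "(A * B) *\<^sub>v v = k \<cdot>\<^sub>v v"
    using assms by (auto simp: eigenvalue_def eigenvector_def)
  define w where "w = B *\<^sub>v v"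
  have w: "w \<in> carrier_vec n"
    unfolding w_def using B v by simp
  have Aw: "A *\<^sub>v w = k \<cdot>\<^sub>v v"
    unfolding w_def using A B v by (simp flip: assoc_mult_mat_vec)
  have "(B * A) *\<^sub>v w = B *\<^sub>v (A *\<^sub>v w)"
    using A B w by simp
  also have "\<dots> = k \<cdot>\<^sub>v w"
    unfolding Aw unfolding w_def using B v by (simp add: mult_mat_vec)
  finally have "(B * A) *\<^sub>v w = k \<cdot>\<^sub>v w" .
  moreover have "w \<noteq> 0\<^sub>v n"
  proof
    assume "w = 0\<^sub>v n"
    moreover have "A *\<^sub>v 0\<^sub>v n = 0\<^sub>v m"
      using A by (intro eq_vecI) auto
    ultimately have "k \<cdot>\<^sub>v v = 0\<^sub>v m"
      using Aw by simp
    then have "k * v $ i = 0" if "i < m" for i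
      using v(1) that by (metis carrier_vecD index_smult_vec(1) index_zero_vec(1))
    then have "v = 0\<^sub>v m"
      using k v(1) by (intro eq_vecI) auto
    then show False
      using v(2) by simp
  qed
  ultimately show ?thesis
    using B w by (auto simp: eigenvalue_def eigenvector_def)
qed

lemma spectrum_mult_swap:
  fixes A B :: "'a :: field mat"
  assumes "A \<in> carrier_mat m n" and "B \<in> carrier_mat n m"
  shows "spectrum (A * B) - {0} = spectrum (B * A) - {0}"
  using eigenvalue_mult_swap[OF assms] eigenvalue_mult_swap[OF assms(2,1)]
  by (auto simp: spectrum_def)

text \<open>Moduli are nonnegative and the spectrum is nonempty for \<open>n > 0\<close>, so
  inserting \<open>0\<close> leaves the maximum unchanged and absorbs a possible eigenvalue
  \<open>0\<close>. The radius thus depends on the nonzero eigenvalues alone, even when there are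
  none.\<close>

lemma spectral_radius_eq_Max_nonzero:
  assumes A: "A \<in> carrier_mat n n" and n: "n > 0"
  shows "spectral_radius A = Max (insert 0 (norm ` (spectrum A - {0})))"
proof -
  have fin: "finite (norm ` spectrum A)" and ne: "norm ` spectrum A \<noteq> {}"
    using card_finite_spectrum(1)[OF A] spectrum_non_empty[OF A n] by auto
  have "0 \<le> spectral_radius A"
    using spectral_radius_mem_max(1)[OF A n] by auto
  then have "spectral_radius A = Max (insert 0 (norm ` spectrum A))"
    using Max_insert[OF fin ne, of 0] by (simp add: spectral_radius_def max_def)
  also have "insert 0 (norm ` spectrum A) = insert 0 (norm ` (spectrum A - {0}))"
    by auto
  finally show ?thesis .
qed

definition incidence_mat :: "nat \<Rightarrow> nat set list \<Rightarrow> real mat" where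
  "incidence_mat n P = mat n (length P) (\<lambda>(i, a). of_bool (i \<in> P ! a))"

definition row_average_mat :: "nat \<Rightarrow> nat set list \<Rightarrow> real mat \<Rightarrow> real mat" where
  "row_average_mat n P C =
     mat (length P) n (\<lambda>(a, j). (\<Sum>i\<in>P ! a. C $$ (i, j)) / real (card (P ! a)))"

lemma indexed_partition_subset:
  assumes "indexed_partition n P" and "a < length P"
  shows "P ! a \<subseteq> {..<n}"
proof -
  have "P ! a \<subseteq> \<Union> (set P)"
    using assms(2) by (intro Union_upper nth_mem)
  then show ?thesis
    using assms(1) by (simp add: indexed_partition_def partition_on_def)
qed

text \<open>Disjointness makes the part containing \<open>i\<close> unique as a set; distinctness of
  the list makes its index unique. The equivalence form lets a sum of indicators over all parts
  collapse to one term.\<close>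

lemma indexed_partition_part:
  assumes "indexed_partition n P" and "i < n"
  obtains a where "a < length P" and "\<And>b. b < length P \<Longrightarrow> i \<in> P ! b \<longleftrightarrow> b = a"
proof -
  have "i \<in> \<Union> (set P)" and dis: "disjoint (set P)" and "distinct P"
    using assms by (auto simp: indexed_partition_def partition_on_def)
  then obtain a where a: "a < length P" "i \<in> P ! a"
    by (auto simp: in_set_conv_nth)
  have "i \<in> P ! b \<longleftrightarrow> b = a" if b: "b < length P" for b
  proof
    assume "i \<in> P ! b"
    then have "P ! a \<inter> P ! b \<noteq> {}"
      using a by blast
    then have "P ! b = P ! a"
      using disjointD[OF dis, of "P ! a" "P ! b"] a b by auto
    then show "b = a"
      using \<open>distinct P\<close> a b by (simp add: nth_eq_iff_index_eq)
  qed (use a in simp)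
  with a(1) show thesis
    by (rule that)
qed

lemma row_average_mult_incidence:
  assumes P: "indexed_partition n P"
  shows "row_average_mat n P C * incidence_mat n P = quotient_mat P C" (is "?D * ?S = _")
proof (rule eq_matI)
  fix a b
  assume "a < dim_row (quotient_mat P C)" "b < dim_col (quotient_mat P C)"
  then have ab: "a < length P" "b < length P"
    by (auto simp: quotient_mat_def)
  have "(?D * ?S) $$ (a, b)
      = (\<Sum>j = 0..<n. (\<Sum>i\<in>P ! a. C $$ (i, j)) / real (card (P ! a)) * of_bool (j \<in> P ! b))"
    using ab by (simp add: row_average_mat_def incidence_mat_def scalar_prod_def)
  \<comment> \<open>The indicator restricts the sum to \<open>P ! b\<close>, which lies inside the
    index range.\<close>
  also have "\<dots> = (\<Sum>j\<in>P ! b. (\<Sum>i\<in>P ! a. C $$ (i, j)) / real (card (P ! a)))"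
    using indexed_partition_subset[OF P ab(2)]
    by (intro sum.mono_neutral_cong_right) auto
  also have "\<dots> = (\<Sum>i\<in>P ! a. \<Sum>j\<in>P ! b. C $$ (i, j)) / real (card (P ! a))"
    by (subst sum.swap) (simp add: sum_divide_distrib)
  finally show "(?D * ?S) $$ (a, b) = quotient_mat P C $$ (a, b)"
    using ab by (simp add: quotient_mat_def)
qed (auto simp: row_average_mat_def incidence_mat_def quotient_mat_def)

lemma incidence_mult_row_average:
  assumes P: "indexed_partition n P" and C: "C \<in> carrier_mat n n"
    and const: "\<forall>a<length P. \<forall>i\<in>P ! a. \<forall>k\<in>P ! a. \<forall>j<n. C $$ (i, j) = C $$ (k, j)"
  shows "incidence_mat n P * row_average_mat n P C = C" (is "?S * ?D = _")
proof (rule eq_matI)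
  fix i j
  assume "i < dim_row C" "j < dim_col C"
  then have ij: "i < n" "j < n"
    using C by auto
  obtain a where a: "a < length P" and part: "\<And>b. b < length P \<Longrightarrow> i \<in> P ! b \<longleftrightarrow> b = a"
    using indexed_partition_part[OF P ij(1)] by blast
  have i: "i \<in> P ! a"
    using a part by simp
  have "finite (P ! a)"
    using indexed_partition_subset[OF P a] by (rule finite_subset) simp
  then have card: "card (P ! a) \<noteq> 0"
    using i by auto
  have "(?S * ?D) $$ (i, j) = (\<Sum>b = 0..<length P. of_bool (i \<in> P ! b) * ?D $$ (b, j))"
    using ij by (simp add: row_average_mat_def incidence_mat_def scalar_prod_def)
  also have "\<dots> = (\<Sum>b = 0..<length P. if b = a then ?D $$ (b, j) else 0)"
    using part by (intro sum.cong) auto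
  also have "\<dots> = (\<Sum>k\<in>P ! a. C $$ (k, j)) / real (card (P ! a))"
    using a ij by (simp add: row_average_mat_def)
  \<comment> \<open>Here the hypothesis on the rows enters: every row averaged over the part equals
    row \<open>i\<close>, so dividing by the nonzero cardinality gives back the entry.\<close>
  also have "(\<Sum>k\<in>P ! a. C $$ (k, j)) = (\<Sum>k\<in>P ! a. C $$ (i, j))"
    by (rule sum.cong) (use const a i ij in blast)+
  finally show "(?S * ?D) $$ (i, j) = C $$ (i, j)"
    using card by simp
qed (use C in \<open>auto simp: row_average_mat_def incidence_mat_def\<close>)

theorem lemma6p2:
  fixes n :: nat and P :: "nat set list" and C :: "real mat"
  assumes "indexed_partition n P"
    and "C \<in> carrier_mat n n"
    and "\<forall>a<length P. \<forall>i\<in>P ! a. \<forall>k\<in>P ! a. \<forall>j<n. C $$ (i, j) = C $$ (k, j)"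
  shows "spectrum (complexify C) - {0} = spectrum (complexify (quotient_mat P C)) - {0}
    \<and> spectral_radius (complexify C) = spectral_radius (complexify (quotient_mat P C))"
proof
  let ?S = "incidence_mat n P" and ?D = "row_average_mat n P C" and ?Q = "quotient_mat P C"
  have S: "?S \<in> carrier_mat n (length P)" and D: "?D \<in> carrier_mat (length P) n"
    by (simp_all add: incidence_mat_def row_average_mat_def)
  \<comment> \<open>The factorizations hold over the reals; complexification respects products and
    carries them to the matrices whose spectra are compared.\<close>
  have "complexify C = complexify ?S * complexify ?D"
    using of_real_hom.mat_hom_mult[OF S D] incidence_mult_row_average[OF assms] by simp
  moreover have "complexify ?Q = complexify ?D * complexify ?S"
    using of_real_hom.mat_hom_mult[OF D S] row_average_mult_incidence[OF assms(1)] by simp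
  ultimately show spec: "spectrum (complexify C) - {0} = spectrum (complexify ?Q) - {0}"
    using S D spectrum_mult_swap[of "complexify ?S" n "length P" "complexify ?D"] by simp
  have CC: "complexify C \<in> carrier_mat n n"
    and QQ: "complexify ?Q \<in> carrier_mat (length P) (length P)"
    using assms(2) by (simp_all add: quotient_mat_def)
  show "spectral_radius (complexify C) = spectral_radius (complexify ?Q)"
  \<comment> \<open>For \<open>n = 0\<close> both spectra are empty and the radius is
    \<open>Max\<close> of an empty set, so the equality is obtained by showing that both matrices
    are the same empty matrix.\<close>
  proof (cases "n = 0")
    case True
    have "P = []"
    proof (rule ccontr)
      assume "P \<noteq> []"
      then have "0 < length P" and "P ! 0 \<in> set P"
        by simp_all
      then have "{} \<in> set P"
        using indexed_partition_subset[OF assms(1), of 0] True by (metis lessThan_0 subset_empty)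
      then show False
        using assms(1) by (simp add: indexed_partition_def partition_on_def)
    qed
    with True CC QQ have "complexify C = complexify ?Q"
      by (intro eq_matI) auto
    then show ?thesis
      by simp
  next
    case False
    then have "n > 0"
      by simp
    \<comment> \<open>The point \<open>0\<close> lies in some part, so the quotient matrix has
      positive dimension and a nonempty spectrum too.\<close>
    moreover obtain a where "a < length P"
      using indexed_partition_part[OF assms(1) \<open>n > 0\<close>] by blast
    then have "length P > 0"
      by (rule le_less_trans[OF le0])
    ultimately show ?thesis
      using spec spectral_radius_eq_Max_nonzero[OF CC] spectral_radius_eq_Max_nonzero[OF QQ] by simp
  qed
qed

end
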